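(* Let $\mathcal{F}:\mathcal{L}_n\to\mathcal{L}_n$ (of the form $\mathcal{F}(x(\cdot))(\xi)=F(x(\xi),\xi)$) be continuous, and assume that $\mathcal{F}$ is pseudomonotone on $\mathcal{C}\cap\mathcal{N}_n$. Then the following statements hold. (a) The solution set $\mathrm{SOL}(\mathcal{C}\cap\mathcal{N}_n,\mathcal{F})$ is convex. (b) If there exists $\hat{x}(\cdot)\in\mathcal{C}\cap\mathcal{N}_n$ such that $\mathcal{F}(\hat{x}(\cdot))\in\mathrm{int}\big(((\mathcal{C}\cap\mathcal{N}_n)_\infty)^*\big)$, then $\mathrm{SOL}(\mathcal{C}\cap\mathcal{N}_n,\mathcal{F})$ is nonempty, convex and compact.
   Context: Let $N\ge1$ and $n_1,\dots,n_N\ge 1$ be integers, $n=\sum_{k=1}^N n_k$. Let $\Xi=\Xi_1\times\cdots\times\Xi_N$ be a finite sample space whose elements $\xi=(\xi_1,\dots,\xi_N)$ have probabilities $p(\xi)>0$ summing to $1$. $\mathcal{L}_n$ is the Hilbert space of all maps $x(\cdot):\Xi\to\mathbb{R}^n$, $x(\xi)=(x_1(\xi),\dots,x_N(\xi))$ with $x_k(\xi)\in\mathbb{R}^{n_k}$, with inner product $\langle x(\cdot),w(\cdot)\rangle=\sum_{\xi\in\Xi}p(\xi)\sum_{k=1}^N\langle x_k(\xi),w_k(\xi)\rangle$. The nonanticipativity subspace is $\mathcal{N}_n=\{x(\cdot)\in\mathcal{L}_n: x_k(\xi)\text{ does not depend on }\xi_k,\dots,\xi_N,\ k=1,\dots,N\}$.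 For each $\xi\in\Xi$ let $C(\xi)\subset\mathbb{R}^n$ be nonempty closed convex, and $\mathcal{C}=\{x(\cdot)\in\mathcal{L}_n:x(\xi)\in C(\xi)\ \forall\xi\in\Xi\}$. The mapping $\mathcal{F}$ is given by $\mathcal{F}(x(\cdot)):\xi\mapsto F(x(\xi),\xi)$, where $F(\cdot,\xi):\mathbb{R}^n\to\mathbb{R}^n$ for each $\xi$. $\mathrm{SOL}(\mathcal{C}\cap\mathcal{N}_n,\mathcal{F})$ is the solution set of the stochastic variational inequality: find $x(\cdot)\in\mathcal{C}\cap\mathcal{N}_n$ with $-\mathcal{F}(x(\cdot))\in N_{\mathcal{C}\cap\mathcal{N}_n}(x(\cdot))$, i.e. $\langle\mathcal{F}(x(\cdot)),y(\cdot)-x(\cdot)\rangle\ge0$ for all $y(\cdot)\in\mathcal{C}\cap\mathcal{N}_n$. $\mathcal{F}$ is pseudomonotone on a set $\mathcal{K}\subset\mathcal{L}_n$ if for all $x(\cdot),y(\cdot)\in\mathcal{K}$: $\langle y(\cdot)-x(\cdot),\mathcal{F}(x(\cdot))\rangle\ge0$ implies $\langle y(\cdot)-x(\cdot),\mathcal{F}(y(\cdot))\rangle\ge0$. For a set $S\subset\mathcal{L}_n$: $S_\infty=\{d:x+\tau d\in S\ \forall x\in S,\ \tau\ge0\}$ is the recession cone, $S^*=\{d:\langle v,d\rangle\ge0\ \forall v\in S\}$ is the dual cone, and $\mathrm{int}$ denotes the interior in $\mathcal{L}_n$. *)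

theory Defs
  imports "HOL-Analysis.Analysis" "HOL-Library.FuncSet"
begin

(* The space of maps x(.) from the sample space to R^n is the type real^'n^'s: the finite type 's
   enumerates the sample space, 'n the coordinates of R^n, and x $ \<xi> is x(\<xi>).  The
   product structures are carried by two bijections:
     \<bullet> coord \<xi> k is the k-th entry \<xi>_k of the scenario \<xi>, with coord a bijection from
       UNIV onto the product PiE {1..N} Xi;
     \<bullet> blk i = (k, j) says that coordinate i of R^n is the j-th coordinate of the block
       R^(n_k), with blk a bijection from UNIV onto (SIGMA k:{1..N}. {1..nk k}).
   The inner product on maps is the expectation below, not the built-in one of real^'n^'s.  As all
   probabilities are positive and everything is finite-dimensional, both induce the same topology,
   so continuous_on, interior and compact are the library notions. *)

definition expect_inner :: "('s::finite \<Rightarrow> real) \<Rightarrow> real^'n^'s \<Rightarrow> real^'n^'s \<Rightarrow> real" where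
  "expect_inner p x w = (\<Sum>\<xi>\<in>UNIV. p \<xi> * ((x $ \<xi>) \<bullet> (w $ \<xi>)))"

(* The block x_k(\<xi>) does not depend on \<xi>_k, ..., \<xi>_N: it agrees on any two scenarios
   with the same entries before k. *)
definition nonanticipative ::
    "nat \<Rightarrow> ('s::finite \<Rightarrow> nat \<Rightarrow> 'a) \<Rightarrow> ('n::finite \<Rightarrow> nat \<times> nat) \<Rightarrow> (real^'n^'s) set" where
  "nonanticipative N coord blk =
     {x. \<forall>k\<in>{1..N}. \<forall>\<xi> \<eta>. (\<forall>l\<in>{1..<k}. coord \<xi> l = coord \<eta> l) \<longrightarrow>
           (\<forall>i. fst (blk i) = k \<longrightarrow> x $ \<xi> $ i = x $ \<eta> $ i)}"

definition scenario_constraints :: "('s::finite \<Rightarrow> (real^'n) set) \<Rightarrow> (real^'n^'s) set" where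
  "scenario_constraints C = {x. \<forall>\<xi>. x $ \<xi> \<in> C \<xi>}"

definition scenario_map ::
    "(real^'n \<Rightarrow> 's::finite \<Rightarrow> real^'n) \<Rightarrow> real^'n^'s \<Rightarrow> real^'n^'s" where
  "scenario_map F x = (\<chi> \<xi>. F (x $ \<xi>) \<xi>)"

definition normal_cone ::
    "('s::finite \<Rightarrow> real) \<Rightarrow> (real^'n^'s) set \<Rightarrow> real^'n^'s \<Rightarrow> (real^'n^'s) set" where
  "normal_cone p K x = {v. x \<in> K \<and> (\<forall>y\<in>K. expect_inner p v (y - x) \<le> 0)}"

definition SOL ::
    "('s::finite \<Rightarrow> real) \<Rightarrow> (real^'n^'s) set \<Rightarrow> (real^'n^'s \<Rightarrow> real^'n^'s) \<Rightarrow> (real^'n^'s) set" where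
  "SOL p K G = {x \<in> K. - G x \<in> normal_cone p K x}"

definition pseudomonotone_on ::
    "('s::finite \<Rightarrow> real) \<Rightarrow> (real^'n^'s) set \<Rightarrow> (real^'n^'s \<Rightarrow> real^'n^'s) \<Rightarrow> bool" where
  "pseudomonotone_on p K G \<longleftrightarrow>
     (\<forall>x\<in>K. \<forall>y\<in>K. expect_inner p (y - x) (G x) \<ge> 0 \<longrightarrow> expect_inner p (y - x) (G y) \<ge> 0)"

definition recession_cone :: "'v::real_vector set \<Rightarrow> 'v set" where
  "recession_cone S = {d. \<forall>x\<in>S. \<forall>\<tau>\<ge>0. x + \<tau> *\<^sub>R d \<in> S}"

definition dual_cone :: "('s::finite \<Rightarrow> real) \<Rightarrow> (real^'n^'s) set \<Rightarrow> (real^'n^'s) set" where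
  "dual_cone p S = {d. \<forall>v\<in>S. expect_inner p v d \<ge> 0}"

end

theory Submission
  imports Defs
begin

text \<open>
  Multiplying each component \<open>w(\<xi>)\<close> by \<open>p(\<xi>)\<close> turns the expectation inner product into the
  Euclidean one, so the stochastic problem is an ordinary variational inequality over the closed
  convex set \<open>K\<close> of admissible nonanticipative maps. With \<open>T\<close> the \<open>p\<close>-weighted \<open>\<F>\<close>, it asks
  to find \<open>x \<in> K\<close> with \<open>T x \<bullet> (y - x) \<ge> 0\<close> for all \<open>y \<in> K\<close>.

  Under pseudomonotonicity and continuity, \<open>x\<close> is a solution exactly when \<open>T y \<bullet> (y - x) \<ge> 0\<close>
  for all \<open>y \<in> K\<close> (\<open>minty\<close>). For fixed \<open>y\<close> this condition is an affine inequality in \<open>x\<close>, so the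
  solution set is an intersection of \<open>K\<close> with closed half-spaces, hence closed and convex.

  For the second part, \<open>\<F> xhat\<close> in the interior of the dual of the recession cone makes
  \<open>T xhat \<bullet> d > 0\<close> for every nonzero recession direction \<open>d\<close>. A closed convex set that is unbounded
  inside a half-space has a recession direction pointing into that half-space
  (\<open>recession_direction_of_unbounded\<close>), so the slice \<open>{x \<in> K. T xhat \<bullet> (x - xhat) \<le> 0}\<close> is bounded.
  All solutions lie in this slice, which gives compactness. For existence, Brouwer's theorem solves
  the inequality on the intersection of \<open>K\<close> with a ball around \<open>xhat\<close> that contains the slice in its
  interior (\<open>vi_solutions_compact_nonempty\<close>). Testing that solution against \<open>xhat\<close> and using
  pseudomonotonicity shows that it is in the slice; so it is not on the sphere, the ball constraint
  is inactive, and it solves the problem on \<open>K\<close>.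
\<close>

section \<open>Pseudomonotone variational inequalities in Euclidean space\<close>

definition vi_solutions :: "'v::real_inner set \<Rightarrow> ('v \<Rightarrow> 'v) \<Rightarrow> 'v set" where
  "vi_solutions K T = {x \<in> K. \<forall>y\<in>K. T x \<bullet> (y - x) \<ge> 0}"

text \<open>The fixed points of the map sending \<open>x\<close> to the projection of \<open>x - T x\<close> onto \<open>K\<close> are solutions,
  since the obtuse-angle characterisation of the projection is then the variational inequality.\<close>

lemma vi_solutions_compact_nonempty:
  fixes K :: "'v::euclidean_space set"
  assumes "compact K" "convex K" "K \<noteq> {}" "continuous_on K T"
  shows "vi_solutions K T \<noteq> {}"
proof -
  have cl: "closed K" by (rule compact_imp_closed[OF assms(1)])
  let ?f = "\<lambda>x. closest_point K (x - T x)"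
  have "continuous_on K (closest_point K \<circ> (\<lambda>x. x - T x))"
    by (intro continuous_on_compose continuous_on_closest_point continuous_intros assms cl)
  then have "continuous_on K ?f" by (simp add: o_def)
  moreover have "?f \<in> K \<rightarrow> K" using closest_point_in_set[OF cl assms(3)] by auto
  ultimately obtain x where x: "x \<in> K" "?f x = x"
    by (rule brouwer[OF assms(1,2,3)])
  have "T x \<bullet> (y - x) \<ge> 0" if "y \<in> K" for y
  proof -
    have "(x - T x - ?f x) \<bullet> (y - ?f x) \<le> 0" by (rule closest_point_dot[OF assms(2) cl that])
    then show ?thesis unfolding x(2) by simp
  qed
  then have "x \<in> vi_solutions K T" using x(1) by (simp add: vi_solutions_def)
  then show ?thesis by blast
qed

text \<open>Minty's lemma. The passage from the tests \<open>T y\<close> to the test \<open>T x\<close> is a limit along the segment: the inequality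
  at \<open>x + t (y - x)\<close>, divided by \<open>t\<close>, tends to the inequality at \<open>x\<close> as \<open>t\<close> decreases to \<open>0\<close>.\<close>

lemma minty:
  fixes K :: "'v::real_inner set"
  assumes conv: "convex K" and cont: "continuous_on K T"
    and pm: "\<And>x y. x \<in> K \<Longrightarrow> y \<in> K \<Longrightarrow> T x \<bullet> (y - x) \<ge> 0 \<Longrightarrow> T y \<bullet> (y - x) \<ge> 0"
  shows "vi_solutions K T = {x \<in> K. \<forall>y\<in>K. T y \<bullet> (y - x) \<ge> 0}"
proof (intro equalityI subsetI)
  fix x assume "x \<in> vi_solutions K T"
  then show "x \<in> {x \<in> K. \<forall>y\<in>K. T y \<bullet> (y - x) \<ge> 0}" using pm unfolding vi_solutions_def by auto
next
  fix x assume "x \<in> {x \<in> K. \<forall>y\<in>K. T y \<bullet> (y - x) \<ge> 0}"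
  then have x: "x \<in> K" and min: "\<And>y. y \<in> K \<Longrightarrow> T y \<bullet> (y - x) \<ge> 0" by auto
  have "T x \<bullet> (y - x) \<ge> 0" if y: "y \<in> K" for y
  proof -
    define t :: "nat \<Rightarrow> real" where "t n = 1 / real (Suc n)" for n
    define z where "z n = x + t n *\<^sub>R (y - x)" for n
    have t: "t n > 0" "t n \<le> 1" for n by (auto simp: t_def divide_simps)
    have "z n = (1 - t n) *\<^sub>R x + t n *\<^sub>R y" for n by (simp add: z_def algebra_simps)
    then have zK: "z n \<in> K" for n
      using convexD[OF conv x y, of "1 - t n" "t n"] t[of n] by auto
    have "t \<longlonglongrightarrow> 0" unfolding t_def using LIMSEQ_inverse_real_of_nat by (simp add: inverse_eq_divide)
    then have "z \<longlonglongrightarrow> x + 0 *\<^sub>R (y - x)" unfolding z_def by (intro tendsto_intros)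
    then have "(\<lambda>n. T (z n)) \<longlonglongrightarrow> T x"
      using continuous_on_tendsto_compose[OF cont _ x, of z sequentially] zK by simp
    then have lim: "(\<lambda>n. T (z n) \<bullet> (y - x)) \<longlonglongrightarrow> T x \<bullet> (y - x)" by (intro tendsto_intros)
    have "T (z n) \<bullet> (y - x) \<ge> 0" for n
      using min[OF zK[of n]] t(1)[of n] by (simp add: z_def zero_le_mult_iff)
    then show ?thesis using LIMSEQ_le_const[OF lim] by auto
  qed
  then show "x \<in> vi_solutions K T" using x unfolding vi_solutions_def by auto
qed

lemma minty_set_eq_half_spaces:
  fixes K :: "'v::real_inner set"
  shows "{x \<in> K. \<forall>y\<in>K. T y \<bullet> (y - x) \<ge> 0} = K \<inter> (\<Inter>y\<in>K. {x. T y \<bullet> x \<le> T y \<bullet> y})"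
  unfolding inner_diff_right by auto

text \<open>Normalised differences from \<open>a\<close> to points escaping to infinity accumulate at a unit vector
  \<open>d\<close>. For \<open>x \<in> K\<close>, the point at distance about \<open>\<tau>\<close> from \<open>x\<close> on the segment towards
  an escaping point lies in \<open>K\<close> by convexity. These points converge to \<open>x + \<tau> d\<close>, because the
  choice of base point, \<open>x\<close> or \<open>a\<close>, does not affect directions at infinity; closedness keeps the
  limit in \<open>K\<close>.\<close>

lemma recession_direction_of_unbounded:
  fixes K :: "'v::euclidean_space set"
  assumes cl: "closed K" and conv: "convex K"
    and unb: "\<not> bounded {x \<in> K. c \<bullet> (x - a) \<le> 0}"
  obtains d where "d \<in> recession_cone K" "d \<noteq> 0" "c \<bullet> d \<le> 0"
proof -
  have "\<exists>x\<in>K. c \<bullet> (x - a) \<le> 0 \<and> norm (x - a) > real (Suc n)" for n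
  proof (rule ccontr)
    assume "\<not> ?thesis"
    then have "{x \<in> K. c \<bullet> (x - a) \<le> 0} \<subseteq> cball a (real (Suc n))"
      by (auto simp: dist_norm norm_minus_commute not_less)
    then show False using unb bounded_cball bounded_subset by blast
  qed
  then obtain w where w: "\<And>n. w n \<in> K" "\<And>n. c \<bullet> (w n - a) \<le> 0"
      "\<And>n. norm (w n - a) > real (Suc n)"
    by metis
  define r where "r n = norm (w n - a)" for n
  have r: "r n > real (Suc n)" for n using w(3) by (simp add: r_def)
  then have rpos: "r n > 0" for n using of_nat_0_le_iff order.strict_trans1 by metis
  have "real n \<le> r n" for n using r[of n] by simp
  then have "filterlim r at_top sequentially"
    by (intro filterlim_at_top_mono[OF filterlim_real_sequentially]) simp
  then have rinv: "(\<lambda>n. inverse (r n)) \<longlonglongrightarrow> 0" by (rule tendsto_inverse_0_at_top)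
  define u where "u n = inverse (r n) *\<^sub>R (w n - a)" for n
  have "u n \<in> sphere 0 1" for n using rpos[of n] by (simp add: u_def r_def)
  then obtain d s where d: "d \<in> sphere 0 1" and s: "strict_mono (s :: nat \<Rightarrow> nat)"
    and lim: "(u \<circ> s) \<longlonglongrightarrow> d"
    using compact_sphere[of "0::'v" 1] unfolding compact_def by metis
  have sinv: "(\<lambda>n. inverse (r (s n))) \<longlonglongrightarrow> 0"
    using LIMSEQ_subseq_LIMSEQ[OF rinv s] by (simp add: o_def)
  have "x + \<tau> *\<^sub>R d \<in> K" if x: "x \<in> K" and \<tau>: "\<tau> \<ge> 0" for x \<tau>
  proof -
    \<comment> \<open>The bracket is \<open>(w (s n) - x) / r (s n)\<close>, written so that its limit \<open>d\<close> can be read off.\<close>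
    let ?q = "\<lambda>n. x + \<tau> *\<^sub>R ((u \<circ> s) n + inverse (r (s n)) *\<^sub>R (a - x))"
    have "?q \<longlonglongrightarrow> x + \<tau> *\<^sub>R (d + 0 *\<^sub>R (a - x))" by (intro tendsto_intros lim sinv)
    then have qlim: "?q \<longlonglongrightarrow> x + \<tau> *\<^sub>R d" by simp
    have "(\<lambda>n. \<tau> * inverse (r (s n))) \<longlonglongrightarrow> \<tau> * 0" by (intro tendsto_intros sinv)
    then have "\<forall>\<^sub>F n in sequentially. \<tau> * inverse (r (s n)) < 1"
      by (intro order_tendstoD(2)[of _ "\<tau> * 0"]) auto
    then have "\<forall>\<^sub>F n in sequentially. ?q n \<in> K"
    proof eventually_elim
      case (elim n)
      let ?l = "\<tau> * inverse (r (s n))"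
      have "?q n = (1 - ?l) *\<^sub>R x + ?l *\<^sub>R w (s n)" by (simp add: u_def algebra_simps)
      then show ?case
        using convexD[OF conv x w(1), of "1 - ?l" ?l "s n"] elim \<tau> rpos[of "s n"] by simp
    qed
    then show ?thesis using Lim_in_closed_set[OF cl _ _ qlim] by auto
  qed
  then have "d \<in> recession_cone K" by (simp add: recession_cone_def)
  moreover have "d \<noteq> 0" using d by auto
  moreover have "c \<bullet> d \<le> 0"
  proof (rule LIMSEQ_le_const2)
    show "(\<lambda>n. c \<bullet> (u \<circ> s) n) \<longlonglongrightarrow> c \<bullet> d" by (intro tendsto_intros lim)
    have "c \<bullet> u n \<le> 0" for n using w(2)[of n] rpos[of n] by (simp add: u_def mult_nonneg_nonpos)
    then show "\<exists>M. \<forall>n\<ge>M. c \<bullet> (u \<circ> s) n \<le> 0" by simp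
  qed
  ultimately show ?thesis by (rule that)
qed

text \<open>A solution of the problem truncated to a ball that is not on the sphere solves the full
  problem: a short initial piece of each segment from it into \<open>K\<close> stays in the ball, and the
  inequality scales along the segment.\<close>

lemma vi_solutions_inactive_ball:
  fixes K :: "'v::real_inner set"
  assumes conv: "convex K" and x: "x \<in> vi_solutions (K \<inter> cball a R) T" and "x \<in> ball a R"
  shows "x \<in> vi_solutions K T"
proof -
  have xK: "x \<in> K" using x by (simp add: vi_solutions_def)
  obtain e where e: "e > 0" "ball x e \<subseteq> ball a R" using open_ball assms(3) openE by blast
  have "T x \<bullet> (y - x) \<ge> 0" if y: "y \<in> K" for y
  proof -
    \<comment> \<open>The summand 1 in the denominator covers \<open>y = x\<close>.\<close>
    define t where "t = min 1 (e / (2 * (norm (y - x) + 1)))"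
    have t: "t > 0" "t \<le> 1" using e(1) by (auto simp: t_def add_nonneg_pos)
    let ?z = "x + t *\<^sub>R (y - x)"
    have "t * norm (y - x) \<le> e / (2 * (norm (y - x) + 1)) * (norm (y - x) + 1)"
      using t e(1) by (intro mult_mono) (auto simp: t_def)
    also have "\<dots> = e / 2"
      using add_nonneg_pos[OF norm_ge_zero[of "y - x"] zero_less_one] by (simp add: field_simps)
    finally have "t * norm (y - x) < e" using e(1) by simp
    then have "?z \<in> ball x e" using t by (simp add: dist_norm)
    moreover have "?z = (1 - t) *\<^sub>R x + t *\<^sub>R y" by (simp add: algebra_simps)
    then have "?z \<in> K" using convexD[OF conv xK y, of "1 - t" t] t by simp
    ultimately have "?z \<in> K \<inter> cball a R" using e(2) ball_subset_cball by blast
    then have "T x \<bullet> (?z - x) \<ge> 0" using x unfolding vi_solutions_def by blast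
    then show ?thesis using t(1) by (simp add: zero_le_mult_iff)
  qed
  then show ?thesis using xK by (simp add: vi_solutions_def)
qed

lemma pseudomonotone_vi_closed_convex:
  fixes K :: "'v::real_inner set"
  assumes "closed K" "convex K" "continuous_on K T"
    and "\<And>x y. x \<in> K \<Longrightarrow> y \<in> K \<Longrightarrow> T x \<bullet> (y - x) \<ge> 0 \<Longrightarrow> T y \<bullet> (y - x) \<ge> 0"
  shows "closed (vi_solutions K T)" "convex (vi_solutions K T)"
proof -
  have "vi_solutions K T = K \<inter> (\<Inter>y\<in>K. {x. T y \<bullet> x \<le> T y \<bullet> y})"
    by (rule trans[OF minty[OF assms(2-4)] minty_set_eq_half_spaces])
  moreover have "closed (K \<inter> (\<Inter>y\<in>K. {x. T y \<bullet> x \<le> T y \<bullet> y}))"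
    by (intro closed_Int closed_INT ballI closed_halfspace_le assms(1))
  moreover have "convex (K \<inter> (\<Inter>y\<in>K. {x. T y \<bullet> x \<le> T y \<bullet> y}))"
    by (intro convex_Int convex_INT convex_halfspace_le assms(2))
  ultimately show "closed (vi_solutions K T)" "convex (vi_solutions K T)" by simp_all
qed

text \<open>The point \<open>a\<close> is the test point against which any solution is compared. Pseudomonotonicity moves
  \<open>T x \<bullet> (a - x) \<ge> 0\<close> to \<open>T a \<bullet> (a - x) \<ge> 0\<close>, which confines \<open>x\<close> to a half-space that does not depend
  on \<open>x\<close>. The argument uses only the one test at \<open>a\<close>, so it bounds the solutions of the problem and
  of its truncations to balls around \<open>a\<close> by the same radius.\<close>

lemma pseudomonotone_vi_coercive:
  fixes K :: "'v::euclidean_space set"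
  assumes cl: "closed K" and conv: "convex K" and cont: "continuous_on K T"
    and pm: "\<And>x y. x \<in> K \<Longrightarrow> y \<in> K \<Longrightarrow> T x \<bullet> (y - x) \<ge> 0 \<Longrightarrow> T y \<bullet> (y - x) \<ge> 0"
    and a: "a \<in> K" and pos: "\<And>d. d \<in> recession_cone K \<Longrightarrow> d \<noteq> 0 \<Longrightarrow> T a \<bullet> d > 0"
  shows "vi_solutions K T \<noteq> {}" "compact (vi_solutions K T)"
proof -
  let ?B = "{x \<in> K. T a \<bullet> (x - a) \<le> 0}"
  have bdd: "bounded ?B"
    using recession_direction_of_unbounded[OF cl conv, of "T a" a] pos by (metis not_less)
  have slice: "x \<in> ?B" if "x \<in> K" "T x \<bullet> (a - x) \<ge> 0" for x
    using pm[OF that(1) a that(2)] that(1) by (simp add: inner_diff_right)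
  then have "vi_solutions K T \<subseteq> ?B" using a unfolding vi_solutions_def by blast
  then show "compact (vi_solutions K T)"
    using bounded_subset[OF bdd] pseudomonotone_vi_closed_convex(1)[OF cl conv cont pm]
    by (simp add: compact_eq_bounded_closed)
  obtain R where R: "R > 0" "?B \<subseteq> ball a R" using bounded_subset_ballD[OF bdd] by blast
  let ?KR = "K \<inter> cball a R"
  have aKR: "a \<in> ?KR" using a R by simp
  have "vi_solutions ?KR T \<noteq> {}"
    using aKR by (intro vi_solutions_compact_nonempty closed_Int_compact convex_Int
        continuous_on_subset[OF cont] cl conv) auto
  then obtain x where x: "x \<in> vi_solutions ?KR T" by auto
  then have "x \<in> K" "T x \<bullet> (a - x) \<ge> 0" using aKR unfolding vi_solutions_def by auto
  then have "x \<in> ball a R" using slice R(2) by blast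
  then show "vi_solutions K T \<noteq> {}" using vi_solutions_inactive_ball[OF conv x] by auto
qed

section \<open>Reduction of the stochastic problem\<close>

definition weight :: "('s::finite \<Rightarrow> real) \<Rightarrow> real^'n^'s \<Rightarrow> real^'n^'s" where
  "weight p w = (\<chi> \<xi>. p \<xi> *\<^sub>R (w $ \<xi>))"

lemma expect_inner_eq_inner_weight: "expect_inner p x w = weight p w \<bullet> x"
  unfolding expect_inner_def weight_def inner_vec_def[where 'a="real^'n"]
  by (intro sum.cong refl) (simp add: inner_commute[of "x $ _"])

lemma expect_inner_pos:
  assumes "\<And>\<xi>. p \<xi> > 0" "v \<noteq> 0"
  shows "expect_inner p v v > 0"
proof -
  obtain \<xi> where "v $ \<xi> \<noteq> 0" using assms(2) by (auto simp: vec_eq_iff)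
  then show ?thesis
    unfolding expect_inner_def using assms(1)
    by (intro sum_pos2[of UNIV \<xi>]) (auto simp: less_imp_le)
qed

lemma continuous_on_weight: "continuous_on S G \<Longrightarrow> continuous_on S (\<lambda>x. weight p (G x))"
  unfolding weight_def by (intro continuous_intros)

lemma SOL_eq_vi_solutions:
  fixes K :: "(real^'n^'s::finite) set"
  shows "SOL p K G = vi_solutions K (\<lambda>x. weight p (G x))"
proof -
  have neg: "expect_inner p (- v) w = - (weight p v \<bullet> w)" for v w :: "real^'n^'s"
    by (simp add: expect_inner_def weight_def inner_vec_def[where 'a="real^'n"] sum_negf)
  show ?thesis by (auto simp: SOL_def normal_cone_def vi_solutions_def neg)
qed

text \<open>From an interior point \<open>c\<close> one can step a little in direction \<open>-v\<close> and stay in the dual cone;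
  pairing with \<open>v\<close> bounds \<open>\<langle>v, c\<rangle>\<close> below by a positive multiple of \<open>\<langle>v, v\<rangle>\<close>.\<close>

lemma interior_dual_cone_pos:
  assumes "\<And>\<xi>. p \<xi> > 0" and c: "c \<in> interior (dual_cone p S)" and v: "v \<in> S" "v \<noteq> 0"
  shows "expect_inner p v c > 0"
proof -
  obtain e where e: "e > 0" "cball c e \<subseteq> dual_cone p S" using c by (auto simp: mem_interior_cball)
  define t where "t = e / norm v"
  have t: "t > 0" using e v by (simp add: t_def)
  have "c - t *\<^sub>R v \<in> cball c e" using e v by (simp add: t_def dist_norm)
  then have "expect_inner p v (c - t *\<^sub>R v) \<ge> 0"
    using e(2) v(1) unfolding dual_cone_def by blast
  moreover have "expect_inner p v (c - t *\<^sub>R v) = expect_inner p v c - t * expect_inner p v v"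
    by (simp add: expect_inner_def inner_diff_right right_diff_distrib sum_subtractf
        sum_distrib_left mult.left_commute)
  ultimately show ?thesis using mult_pos_pos[OF t expect_inner_pos[of p v]] assms(1) v(2) by simp
qed

lemma subspace_nonanticipative:
  "subspace (nonanticipative N coord blk :: (real^'b::finite^'a::finite) set)"
proof (rule subspaceI)
  fix x y :: "real^'b^'a" and c :: real
  assume x: "x \<in> nonanticipative N coord blk"
  show "c *\<^sub>R x \<in> nonanticipative N coord blk"
    unfolding nonanticipative_def
  proof (intro CollectI ballI allI impI)
    fix k \<xi> \<eta> i
    assume "k \<in> {1..N}" "\<forall>l\<in>{1..<k}. coord \<xi> l = coord \<eta> l" "fst (blk i) = k"
    then have "x $ \<xi> $ i = x $ \<eta> $ i" using x unfolding nonanticipative_def by blast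
    then show "(c *\<^sub>R x) $ \<xi> $ i = (c *\<^sub>R x) $ \<eta> $ i" by simp
  qed
  assume y: "y \<in> nonanticipative N coord blk"
  show "x + y \<in> nonanticipative N coord blk"
    unfolding nonanticipative_def
  proof (intro CollectI ballI allI impI)
    fix k \<xi> \<eta> i
    assume "k \<in> {1..N}" "\<forall>l\<in>{1..<k}. coord \<xi> l = coord \<eta> l" "fst (blk i) = k"
    then have "x $ \<xi> $ i = x $ \<eta> $ i" "y $ \<xi> $ i = y $ \<eta> $ i"
      using x y unfolding nonanticipative_def by blast+
    then show "(x + y) $ \<xi> $ i = (x + y) $ \<eta> $ i" by simp
  qed
qed (simp add: nonanticipative_def)

lemma closed_scenario_constraints:
  assumes "\<And>\<xi>. closed (C \<xi>)"
  shows "closed (scenario_constraints C)"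
proof -
  have "scenario_constraints C = (\<Inter>\<xi>. (\<lambda>x. x $ \<xi>) -` C \<xi>)"
    by (auto simp: scenario_constraints_def)
  then show ?thesis
    using assms by (simp add: closed_INT continuous_closed_vimage)
qed

lemma convex_scenario_constraints:
  assumes "\<And>\<xi>. convex (C \<xi>)"
  shows "convex (scenario_constraints C)"
  using assms by (auto simp: convex_def scenario_constraints_def)

theorem theorem6:
  fixes N :: nat and nk :: "nat \<Rightarrow> nat"
    and Xi :: "nat \<Rightarrow> 'a set"
    and coord :: "'s::finite \<Rightarrow> nat \<Rightarrow> 'a"
    and blk :: "'n::finite \<Rightarrow> nat \<times> nat"
    and p :: "'s \<Rightarrow> real"
    and C :: "'s \<Rightarrow> (real^'n) set"
    and F :: "real^'n \<Rightarrow> 's \<Rightarrow> real^'n"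
  assumes "N \<ge> 1" and "\<And>k. k \<in> {1..N} \<Longrightarrow> nk k \<ge> 1"
    and "bij_betw coord UNIV (PiE {1..N} Xi)"
    and "bij_betw blk UNIV (SIGMA k:{1..N}. {1..nk k})"
    and "\<And>\<xi>. p \<xi> > 0" and "(\<Sum>\<xi>\<in>UNIV. p \<xi>) = 1"
    and "\<And>\<xi>. C \<xi> \<noteq> {}" and "\<And>\<xi>. closed (C \<xi>)" and "\<And>\<xi>. convex (C \<xi>)"
    and "continuous_on UNIV (scenario_map F)"
    and "pseudomonotone_on p (scenario_constraints C \<inter> nonanticipative N coord blk) (scenario_map F)"
  shows "convex (SOL p (scenario_constraints C \<inter> nonanticipative N coord blk) (scenario_map F))
    \<and> ((\<exists>xhat \<in> scenario_constraints C \<inter> nonanticipative N coord blk.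
           scenario_map F xhat \<in> interior (dual_cone p
             (recession_cone (scenario_constraints C \<inter> nonanticipative N coord blk))))
       \<longrightarrow> SOL p (scenario_constraints C \<inter> nonanticipative N coord blk) (scenario_map F) \<noteq> {}
         \<and> convex (SOL p (scenario_constraints C \<inter> nonanticipative N coord blk) (scenario_map F))
         \<and> compact (SOL p (scenario_constraints C \<inter> nonanticipative N coord blk) (scenario_map F)))"
proof -
  let ?K = "scenario_constraints C \<inter> nonanticipative N coord blk"
  let ?G = "scenario_map F"
  let ?T = "\<lambda>x. weight p (?G x)"
  have cl: "closed ?K"
    using assms(8) by (intro closed_Int closed_scenario_constraints
        closed_subspace[OF subspace_nonanticipative])
  have conv: "convex ?K"
    using assms(9) by (intro convex_Int convex_scenario_constraints
        subspace_imp_convex[OF subspace_nonanticipative])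
  have cont: "continuous_on ?K ?T"
    by (intro continuous_on_weight continuous_on_subset[OF assms(10)]) simp
  have pm: "?T y \<bullet> (y - x) \<ge> 0" if x: "x \<in> ?K" and y: "y \<in> ?K" and le: "?T x \<bullet> (y - x) \<ge> 0"
    for x y
    using bspec[OF bspec[OF assms(11)[unfolded pseudomonotone_on_def] x] y] le
    by (simp only: expect_inner_eq_inner_weight)
  have cvx: "convex (SOL p ?K ?G)"
    unfolding SOL_eq_vi_solutions by (rule pseudomonotone_vi_closed_convex(2)[OF cl conv cont pm])
  have "SOL p ?K ?G \<noteq> {} \<and> compact (SOL p ?K ?G)"
    if a: "a \<in> ?K" and int: "?G a \<in> interior (dual_cone p (recession_cone ?K))" for a
  proof -
    have pos: "?T a \<bullet> d > 0" if "d \<in> recession_cone ?K" "d \<noteq> 0" for d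
      using interior_dual_cone_pos[OF assms(5) int that]
      by (simp add: expect_inner_eq_inner_weight)
    show ?thesis
      unfolding SOL_eq_vi_solutions
      by (intro conjI pseudomonotone_vi_coercive[OF cl conv cont pm a pos])
  qed
  with cvx show ?thesis by blast
qed

end
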